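(* Let $q$ be a complex number with $|q|<1$. Then $$\sum_{n=0}^{\infty}\frac{(-q;q^2)_{n}\,q^{n^2+2n}}{(q^4;q^4)_{n}}=\frac{(q^6;q^{12})_{\infty}}{(q^3,q^4,q^8,q^9;q^{12})_{\infty}}.$$
   Context: For $n\in\mathbb Z_{\ge 0}\cup\{\infty\}$, $(a;q)_n:=\prod_{j=0}^{n-1}(1-aq^j)$ and $(a_1,\ldots,a_r;q)_n:=\prod_{j=1}^r(a_j;q)_n$ (and similarly with base $q$ replaced by a power of $q$). *)

theory Defs
  imports "HOL-Analysis.Analysis"
begin

definition qpoch :: "complex \<Rightarrow> complex \<Rightarrow> nat \<Rightarrow> complex" where
  "qpoch a q n = (\<Prod>j<n. 1 - a * q ^ j)"

text \<open>
  A value of the infinite product exists for every \<open>a\<close> as soon as \<open>norm q < 1\<close>; the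
  convention of \<^const>\<open>prodinf\<close> also covers the case that some factor vanishes (value 0).
\<close>

definition qpoch_inf :: "complex \<Rightarrow> complex \<Rightarrow> complex" where
  "qpoch_inf a q = (\<Prod>j. 1 - a * q ^ j)"

definition qpochs_inf :: "complex list \<Rightarrow> complex \<Rightarrow> complex" where
  "qpochs_inf as q = (\<Prod>a\<leftarrow>as. qpoch_inf a q)"

end

theory Submission
  imports Defs
begin

text \<open>
  Inserting the Bailey pair \<open>\<beta>\<^sub>n = 1 / (p\<^sup>2;p\<^sup>2)\<^sub>n\<close>,
  \<open>\<alpha>\<^sub>r = (-1)\<^sup>r p ^ r\<^sup>2 (1 - p ^ (2r+1)) / (1 - p)\<close> with \<open>p = q\<^sup>2\<close> and \<open>a = p\<close> into the finite
  Bailey lemma with \<open>\<rho>\<^sub>1 = -q\<close> and \<open>\<rho>\<^sub>2 \<rightarrow> \<infinity>\<close> gives an identity of finite sums. By Tannery's theorem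
  its limit expresses the series as \<open>(-q;q\<^sup>2)\<^sub>\<infinity> / (q\<^sup>2;q\<^sup>2)\<^sub>\<infinity>\<close> times the theta series
  \<open>\<Sum>r\<ge>0. (-1)\<^sup>r q ^ (3r\<^sup>2+2r) (1 - q ^ (2r+1))\<close>, which the Jacobi triple product evaluates as
  \<open>(q,q\<^sup>5,q\<^sup>6;q\<^sup>6)\<^sub>\<infinity>\<close>. Splitting all products modulo 12 yields the claim.
\<close>

section \<open>Finite \<open>q\<close>-Pochhammer symbols and \<open>q\<close>-binomial coefficients\<close>

lemma qpoch_0 [simp]: "qpoch a q 0 = 1"
  by (simp add: qpoch_def)

lemma qpoch_Suc: "qpoch a q (Suc n) = qpoch a q n * (1 - a * q ^ n)"
  by (simp add: qpoch_def)

lemma qpoch_add: "qpoch a q (m + n) = qpoch a q m * qpoch (a * q ^ m) q n"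
  by (induction n) (simp_all add: qpoch_Suc power_add mult_ac)

lemma qpoch_Suc_shift: "qpoch a q (Suc n) = (1 - a) * qpoch (a * q) q n"
  using qpoch_add[of a q 1 n] by (simp add: qpoch_Suc)

lemma one_minus_mult_power_nonzero:
  fixes a q :: complex
  assumes "norm a < 1" "norm q < 1"
  shows "1 - a * q ^ n \<noteq> 0"
proof -
  have "norm (a * q ^ n) \<le> norm a"
    using assms by (simp add: norm_mult norm_power mult_left_le power_le_one)
  with assms show ?thesis by auto
qed

lemma qpoch_nonzero: "norm a < 1 \<Longrightarrow> norm q < 1 \<Longrightarrow> qpoch a q n \<noteq> 0"
  using one_minus_mult_power_nonzero by (simp add: qpoch_def)

lemma one_minus_power_Suc_nonzero:
  fixes q :: complex
  shows "norm q < 1 \<Longrightarrow> 1 - q ^ Suc n \<noteq> 0"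
  using one_minus_mult_power_nonzero[of q q n] by simp

lemma add_choose_two: "(a + b) choose 2 = (a choose 2) + (b choose 2) + a * b"
  by (induction b) (simp_all add: numeral_2_eq_2)

text \<open>Pascal's rule serves as the definition instead of the quotient of Pochhammer symbols: no
  denominators occur, and weighted sums yield to induction on the upper index.\<close>

fun qbinom :: "complex \<Rightarrow> nat \<Rightarrow> nat \<Rightarrow> complex" where
  "qbinom q n 0 = 1"
| "qbinom q 0 (Suc k) = 0"
| "qbinom q (Suc n) (Suc k) = q ^ Suc k * qbinom q n (Suc k) + qbinom q n k"

lemma qbinom_eq_0: "n < k \<Longrightarrow> qbinom q n k = 0"
  by (induction q n k rule: qbinom.induct) simp_all

lemma qbinom_self [simp]: "qbinom q n n = 1"
  by (induction n) (simp_all add: qbinom_eq_0)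

lemma qbinom_qpoch:
  "k \<le> n \<Longrightarrow> qbinom q n k * (qpoch q q k * qpoch q q (n - k)) = qpoch q q n"
proof (induction q n k rule: qbinom.induct)
  case (3 q n k)
  show ?case
  proof (cases "k = n")
    case True
    then show ?thesis using 3 by (simp add: qbinom_eq_0 qpoch_Suc algebra_simps)
  next
    case False
    with 3 obtain d where n: "n = Suc (k + d)"
      by (metis Suc_le_mono le_neq_implies_less less_imp_Suc_add)
    have 1: "qbinom q n (Suc k) * (qpoch q q (Suc k) * qpoch q q d) = qpoch q q n"
      using 3 n by simp
    have 2: "qbinom q n k * (qpoch q q k * qpoch q q (Suc d)) = qpoch q q n"
      using 3 n by (simp add: Suc_diff_le)
    \<comment> \<open>Both Pascal summands become multiples of \<open>qpoch q q n\<close>; the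
      weights add up by
      \<open>q^(k+1) * (1 - q^(d+1)) + (1 - q^(k+1)) = 1 - q^(k+d+2)\<close>.\<close>
    have "qbinom q (Suc n) (Suc k) * (qpoch q q (Suc k) * qpoch q q (Suc n - Suc k)) =
      q ^ Suc k * (1 - q ^ Suc d) * (qbinom q n (Suc k) * (qpoch q q (Suc k) * qpoch q q d)) +
      (1 - q ^ Suc k) * (qbinom q n k * (qpoch q q k * qpoch q q (Suc d)))"
      using n by (simp add: qpoch_Suc Suc_diff_le algebra_simps)
    also have "\<dots> = (1 - q ^ Suc n) * qpoch q q n"
      unfolding 1 2 by (simp add: n power_add algebra_simps)
    finally show ?thesis by (simp add: qpoch_Suc)
  qed
qed simp_all

lemma qbinom_eq_quotient:
  assumes "norm q < 1" "k \<le> n"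
  shows "qbinom q n k = qpoch q q n / (qpoch q q k * qpoch q q (n - k))"
  using qbinom_qpoch[OF assms(2), of q] assms(1) by (simp add: field_simps qpoch_nonzero)

text \<open>Pascal's rule moved from the coefficients to an arbitrary weight \<open>f\<close>; this
  is the inductive step for \<open>q_Chu_Vandermonde\<close>.\<close>

lemma sum_qbinom_Suc:
  "(\<Sum>k\<le>Suc n. qbinom q (Suc n) k * f k) =
   (\<Sum>k\<le>n. qbinom q n k * (q ^ k * f k + f (Suc k)))"
proof -
  have "(\<Sum>k\<le>Suc n. qbinom q (Suc n) k * f k) =
      f 0 + (\<Sum>k\<le>n. q ^ Suc k * qbinom q n (Suc k) * f (Suc k)) +
      (\<Sum>k\<le>n. qbinom q n k * f (Suc k))"
    by (subst sum.atMost_Suc_shift) (simp add: sum.distrib algebra_simps)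
  also have "f 0 + (\<Sum>k\<le>n. q ^ Suc k * qbinom q n (Suc k) * f (Suc k)) =
      (\<Sum>k\<le>Suc n. q ^ k * qbinom q n k * f k)"
    by (subst sum.atMost_Suc_shift) simp
  also have "\<dots> = (\<Sum>k\<le>n. q ^ k * qbinom q n k * f k)"
    by (simp add: qbinom_eq_0)
  finally show ?thesis by (simp add: sum.distrib algebra_simps)
qed

text \<open>
  Clearing the denominators \<open>(x * y; q)\<^sub>k\<close> makes this a polynomial identity, and Pascal's rule
  then gives \<open>S\<^sub>n\<^sub>+\<^sub>1(y) = (1 - y) * S\<^sub>n(y * q)\<close> for the left-hand side \<open>S\<^sub>n(y)\<close>.
\<close>

lemma q_Chu_Vandermonde:
  "(\<Sum>k\<le>n. qbinom q n k * (qpoch x q k * (- y) ^ k * q ^ (k choose 2) *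
      qpoch (x * y * q ^ k) q (n - k))) = qpoch y q n"
proof (induction n arbitrary: y)
  case (Suc n)
  let ?g = "\<lambda>k. qpoch x q k * (- (y * q)) ^ k * q ^ (k choose 2) *
      qpoch (x * (y * q) * q ^ k) q (n - k)"
  have "(\<Sum>k\<le>Suc n. qbinom q (Suc n) k * (qpoch x q k * (- y) ^ k * q ^ (k choose 2) *
      qpoch (x * y * q ^ k) q (Suc n - k))) =
    (\<Sum>k\<le>n. qbinom q n k * ((1 - y) * ?g k))"
    unfolding sum_qbinom_Suc
  proof (intro sum.cong refl)
    fix k assume "k \<in> {..n}"
    then have k: "Suc n - k = Suc (n - k)" by auto
    have pm: "(- (y * q)) ^ k = q ^ k * (- y) ^ k" "(- (q * y)) ^ k = q ^ k * (- y) ^ k"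
      using power_mult_distrib[of q "- y" k] by (simp_all add: mult.commute)
    \<comment> \<open>Both shares of the weight are multiples of \<open>?g k\<close>, with factors
      \<open>1 - x*y*q^k\<close> and \<open>-y*(1 - x*q^k)\<close>; their sum \<open>1 - y\<close>
      is free of \<open>k\<close>.\<close>
    have 1: "q ^ k * (qpoch x q k * (- y) ^ k * q ^ (k choose 2) *
        qpoch (x * y * q ^ k) q (Suc n - k)) = (1 - x * y * q ^ k) * ?g k"
      unfolding k qpoch_Suc_shift by (simp add: pm mult_ac)
    have 2: "qpoch x q (Suc k) * (- y) ^ Suc k * q ^ (Suc k choose 2) *
        qpoch (x * y * q ^ Suc k) q (Suc n - Suc k) = - y * (1 - x * q ^ k) * ?g k"
      by (simp add: qpoch_Suc numeral_2_eq_2 power_add pm mult_ac)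
    show "qbinom q n k *
         (q ^ k * (qpoch x q k * (- y) ^ k * q ^ (k choose 2) * qpoch (x * y * q ^ k) q (Suc n - k)) +
          qpoch x q (Suc k) * (- y) ^ Suc k * q ^ (Suc k choose 2) *
          qpoch (x * y * q ^ Suc k) q (Suc n - Suc k)) = qbinom q n k * ((1 - y) * ?g k)"
      unfolding 1 2 by (simp add: algebra_simps)
  qed
  also have "\<dots> = (1 - y) * (\<Sum>k\<le>n. qbinom q n k * ?g k)"
    by (simp add: sum_distrib_left mult_ac)
  also have "\<dots> = qpoch y q (Suc n)"
    unfolding Suc.IH qpoch_Suc_shift ..
  finally show ?case .
qed (simp add: numeral_2_eq_2)

lemma qpoch_base_0: "qpoch 0 q n = 1"
  by (simp add: qpoch_def)

lemma q_binomial_theorem: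
  "(\<Sum>k\<le>n. qbinom q n k * ((- y) ^ k * q ^ (k choose 2))) = qpoch y q n"
  using q_Chu_Vandermonde[of q n 0 y] by (simp add: qpoch_base_0)

section \<open>Bailey pairs\<close>

text \<open>
  The Bailey pair relative to \<open>a = q\<close> with \<open>\<beta>\<^sub>n = 1 / (q\<^sup>2;q\<^sup>2)\<^sub>n\<close>,
  in the form where the factor \<open>1 - q\<close> of \<open>(q\<^sup>2;q)\<^sub>n\<^sub>+\<^sub>r = (q;q)\<^sub>n\<^sub>+\<^sub>r\<^sub>+\<^sub>1 / (1 - q)\<close>
  is cancelled. The proof is by a WZ certificate \<open>G\<close>.
\<close>

lemma Bailey_pair_sum:
  fixes q :: complex
  assumes q: "norm q < 1"
  shows "(\<Sum>r\<le>n. (-1) ^ r * q ^ r\<^sup>2 * (1 - q ^ (2 * r + 1)) /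
            (qpoch q q (n - r) * qpoch q q (n + r + 1))) = 1 / qpoch (q\<^sup>2) (q\<^sup>2) n"
proof (induction n)
  case 0
  then show ?case using one_minus_power_Suc_nonzero[OF q, of 0] by (simp add: qpoch_Suc)
next
  case (Suc n)
  define t where "t n r = (-1) ^ r * q ^ r\<^sup>2 * (1 - q ^ (2 * r + 1)) /
            (qpoch q q (n - r) * qpoch q q (n + r + 1))" for n r
  define G where "G r = - ((-1) ^ r * q ^ r\<^sup>2 * q ^ (n + 1 - r) * (1 - q ^ (2 * r))) /
            (qpoch q q (n + 1 - r) * qpoch q q (n + r + 1))" for r
  \<comment> \<open>The quotient of the right-hand denominators for \<open>n + 1\<close> and
    \<open>n\<close>, so the goal is that \<open>?c\<close> times the sum for \<open>n + 1\<close>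
    equals the sum for \<open>n\<close>.\<close>
  let ?c = "1 - q ^ (2 * n + 2)"
  have c: "?c \<noteq> 0" using one_minus_power_Suc_nonzero[OF q, of "2 * n + 1"] by simp
  have step: "?c * t (Suc n) r - t n r = G (Suc r) - G r" if r: "r \<le> n" for r
  proof -
    obtain d where n: "n = r + d" using r le_Suc_ex by blast
    \<comment> \<open>With \<open>n = r + d\<close> all powers are monomials in \<open>q\<close>,
      \<open>u\<close>, \<open>z\<close> up to the common factor \<open>E\<close>; over the
      denominator \<open>D\<close> the claim is a polynomial identity.\<close>
    define u z where "u = q ^ r" and "z = q ^ d"
    define P Q where "P = qpoch q q d" and "Q = qpoch q q (2 * r + d + 1)"
    have u2: "q ^ (2 * r) = u\<^sup>2" and z2: "q ^ (2 * d) = z\<^sup>2"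
      by (simp_all add: u_def z_def mult.commute flip: power_mult)
    have qz: "q ^ Suc d = q * z" and quz: "q ^ Suc (2 * r + d + 1) = q\<^sup>2 * u\<^sup>2 * z"
      by (simp_all add: power_add u2 z_def power2_eq_square)
    have nz: "P \<noteq> 0" "Q \<noteq> 0" "1 - q * z \<noteq> 0" "1 - q\<^sup>2 * u\<^sup>2 * z \<noteq> 0"
      using q one_minus_power_Suc_nonzero[OF q, of d]
        one_minus_power_Suc_nonzero[OF q, of "2 * r + d + 1"]
      unfolding P_def Q_def qz quz by (simp_all add: qpoch_nonzero)
    define E where "E = (-1) ^ r * q ^ r\<^sup>2"
    have E: "(-1) ^ Suc r * q ^ (Suc r)\<^sup>2 = - E * (u\<^sup>2 * q)"
      by (simp add: E_def u_def power2_eq_square power_add mult_ac)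
    have A: "qpoch q q (Suc n - r) = P * (1 - q * z)"
      "qpoch q q (n + 1 - r) = P * (1 - q * z)" "qpoch q q (n - r) = P"
      "qpoch q q (n + 1 - Suc r) = P"
      by (simp_all add: n P_def z_def qpoch_Suc Suc_diff_le)
    have i: "Suc n + r + 1 = Suc (2 * r + d + 1)" "n + Suc r + 1 = Suc (2 * r + d + 1)"
        "n + r + 1 = 2 * r + d + 1" using n by auto
    have B: "qpoch q q (Suc n + r + 1) = Q * (1 - q\<^sup>2 * u\<^sup>2 * z)"
      "qpoch q q (n + Suc r + 1) = Q * (1 - q\<^sup>2 * u\<^sup>2 * z)" "qpoch q q (n + r + 1) = Q"
      unfolding i qpoch_Suc Q_def by (simp_all add: power_add u2 u2[unfolded mult.commute[of 2]] z_def power2_eq_square mult_ac)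
    have C: "q ^ (2 * r + 1) = q * u\<^sup>2" "q ^ (2 * n + 2) = q\<^sup>2 * u\<^sup>2 * z\<^sup>2"
        "q ^ (n + 1 - r) = q * z" "q ^ (n + 1 - Suc r) = z" "q ^ (2 * Suc r) = q\<^sup>2 * u\<^sup>2"
      by (simp_all add: n distrib_left power_add u2 z2 z_def power2_eq_square)
    have 1: "?c * t (Suc n) r = (1 - q\<^sup>2 * u\<^sup>2 * z\<^sup>2) * (E * (1 - q * u\<^sup>2)) / (P * (1 - q * z) * (Q * (1 - q\<^sup>2 * u\<^sup>2 * z)))"
      unfolding t_def A B C E_def by simp
    have 2: "t n r = E * (1 - q * u\<^sup>2) / (P * Q)"
      unfolding t_def A B C E_def by simp
    have 3: "G r = - (E * (q * z) * (1 - u\<^sup>2)) / (P * (1 - q * z) * Q)"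
      unfolding G_def A B C E_def u2 by simp
    have 4: "G (Suc r) = - (- E * (u\<^sup>2 * q) * z * (1 - q\<^sup>2 * u\<^sup>2)) / (P * (Q * (1 - q\<^sup>2 * u\<^sup>2 * z)))"
      unfolding G_def A B C E by simp
    show ?thesis
    proof -
      define D where "D = P * (1 - q * z) * (Q * (1 - q\<^sup>2 * u\<^sup>2 * z))"
      have 2: "t n r = E * (1 - q * u\<^sup>2) * (1 - q * z) * (1 - q\<^sup>2 * u\<^sup>2 * z) / D"
        and 3: "G r = - (E * (q * z) * (1 - u\<^sup>2) * (1 - q\<^sup>2 * u\<^sup>2 * z)) / D"
        and 4: "G (Suc r) = E * (u\<^sup>2 * q) * z * (1 - q\<^sup>2 * u\<^sup>2) * (1 - q * z) / D"
        unfolding 2 3 4 D_def using nz by (simp_all add: mult_ac)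
      show ?thesis
        unfolding 1 2 3 4 D_def[symmetric] diff_divide_distrib[symmetric]
        by (intro arg_cong2[where f = divide] refl) (simp add: algebra_simps power2_eq_square)
    qed
  qed
  \<comment> \<open>Under truncated subtraction \<open>t n (n + 1)\<close> is not a term of the sum
    for \<open>n\<close>, so this index stands apart. Its term cancels \<open>G (Suc n)\<close>;
    with \<open>G 0 = 0\<close> nothing of the telescoping sum remains.\<close>
  have last: "?c * t (Suc n) (Suc n) = - G (Suc n)"
  proof -
    have "1 - q ^ (2 * Suc n + 1) \<noteq> 0"
      using one_minus_power_Suc_nonzero[OF q, of "2 * Suc n"] by simp
    moreover have "Suc n + Suc n + 1 = Suc (2 * Suc n)" "n + Suc n + 1 = 2 * Suc n" by auto
    moreover have "q ^ (2 * n + 2) = q ^ (2 * Suc n)" by simp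
    moreover have "qpoch q q (Suc (2 * Suc n)) = qpoch q q (2 * Suc n) * (1 - q ^ (2 * Suc n + 1))"
      by (simp add: qpoch_Suc)
    ultimately show ?thesis
      unfolding t_def G_def by (simp del: mult_Suc_right power_Suc)
  qed
  have "?c * (\<Sum>r\<le>Suc n. t (Suc n) r) - (\<Sum>r\<le>n. t n r) =
      (\<Sum>r\<le>n. ?c * t (Suc n) r - t n r) + ?c * t (Suc n) (Suc n)"
    unfolding sum_subtractf sum_distrib_left[symmetric] sum.atMost_Suc distrib_left
    by (rule diff_add_eq[symmetric])
  also have "(\<Sum>r\<le>n. ?c * t (Suc n) r - t n r) = (\<Sum>r\<le>n. G (Suc r) - G r)"
    using step by (intro sum.cong) auto
  also have "\<dots> = G (Suc n) - G 0"
    using sum_lessThan_telescope[of G "Suc n"] by (simp add: lessThan_Suc_atMost)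
  finally have "?c * (\<Sum>r\<le>Suc n. t (Suc n) r) = (\<Sum>r\<le>n. t n r)"
    unfolding last by (simp add: G_def)
  also have "\<dots> = 1 / qpoch (q\<^sup>2) (q\<^sup>2) n"
    using Suc.IH unfolding t_def .
  finally have "(\<Sum>r\<le>Suc n. t (Suc n) r) = 1 / (qpoch (q\<^sup>2) (q\<^sup>2) n * ?c)"
    using c by (metis divide_divide_eq_left nonzero_mult_div_cancel_left)
  also have "qpoch (q\<^sup>2) (q\<^sup>2) n * ?c = qpoch (q\<^sup>2) (q\<^sup>2) (Suc n)"
    unfolding qpoch_Suc by (simp add: power_mult power2_eq_square mult.assoc)
  finally show ?case unfolding t_def .
qed

text \<open>
  The finite Bailey lemma with \<open>\<rho>\<^sub>1 = \<rho>\<close> and \<open>\<rho>\<^sub>2 \<rightarrow> \<infinity>\<close>; the parameter \<open>a\<close> is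
  \<open>\<rho> * \<sigma> / q\<close>, so \<open>\<sigma> = a * q / \<rho>\<close>.
\<close>

lemma Bailey_lemma_finite:
  fixes q \<rho> \<sigma> :: complex
  assumes q: "norm q < 1" and \<rho>\<sigma>: "norm (\<rho> * \<sigma>) < 1"
    and \<beta>: "\<And>n. \<beta> n = (\<Sum>r\<le>n. \<alpha> r / (qpoch q q (n - r) * qpoch (\<rho> * \<sigma>) q (n + r)))"
  shows "(\<Sum>n\<le>N. qpoch \<rho> q n * (- \<sigma>) ^ n * q ^ (n choose 2) * \<beta> n / qpoch q q (N - n)) =
    (\<Sum>r\<le>N. qpoch \<rho> q r * qpoch (\<sigma> * q ^ r) q (N - r) * (- \<sigma>) ^ r * q ^ (r choose 2) * \<alpha> r /
      (qpoch q q (N - r) * qpoch (\<rho> * \<sigma>) q (N + r)))"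
proof -
  define w where "w n = qpoch \<rho> q n * (- \<sigma>) ^ n * q ^ (n choose 2)" for n
  \<comment> \<open>The coefficient of \<open>\<alpha> r\<close> after interchanging the sums.
    Shifting \<open>n = m + r\<close> turns it into \<open>q_Chu_Vandermonde\<close> of length
    \<open>M\<close> at \<open>?x\<close>, \<open>?y\<close>.\<close>
  have inner: "(\<Sum>n\<in>{r..N}. w n / (qpoch q q (N - n) * qpoch q q (n - r) * qpoch (\<rho> * \<sigma>) q (n + r))) =
      w r * qpoch (\<sigma> * q ^ r) q (N - r) / (qpoch q q (N - r) * qpoch (\<rho> * \<sigma>) q (N + r))"
    if "r \<le> N" for r
  proof -
    define M where "M = N - r"
    have N: "N = r + M" using that by (simp add: M_def)
    have nz: "qpoch q q k \<noteq> 0" "qpoch (\<rho> * \<sigma>) q k \<noteq> 0" for k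
      using q \<rho>\<sigma> by (simp_all add: qpoch_nonzero)
    let ?x = "\<rho> * q ^ r" and ?y = "\<sigma> * q ^ r"
    have "(\<Sum>n\<in>{r..N}. w n / (qpoch q q (N - n) * qpoch q q (n - r) * qpoch (\<rho> * \<sigma>) q (n + r))) =
      (\<Sum>m\<le>M. w (m + r) / (qpoch q q (M - m) * qpoch q q m * qpoch (\<rho> * \<sigma>) q (2 * r + m)))"
      by (rule sum.reindex_bij_witness[of _ "\<lambda>m. m + r" "\<lambda>n. n - r"]) (auto simp: N mult_2 add_ac)
    also have "\<dots> = (\<Sum>m\<le>M. w r / (qpoch q q M * qpoch (\<rho> * \<sigma>) q (2 * r + M)) *
      (qbinom q M m * (qpoch ?x q m * (- ?y) ^ m * q ^ (m choose 2) * qpoch (?x * ?y * q ^ m) q (M - m))))"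
    proof (intro sum.cong refl)
      fix m assume "m \<in> {..M}"
      then have m: "m \<le> M" by simp
      have pm: "(- ?y) ^ m = (- \<sigma>) ^ m * q ^ (r * m)" "(- (q ^ r * \<sigma>)) ^ m = (- \<sigma>) ^ m * q ^ (r * m)"
        using power_mult_distrib[of "- \<sigma>" "q ^ r" m] by (simp_all add: power_mult mult.commute[of "q ^ r" \<sigma>])
      have 1: "w (m + r) = w r * (qpoch ?x q m * (- ?y) ^ m * q ^ (m choose 2))"
        unfolding w_def by (simp add: add.commute[of m r] qpoch_add add_choose_two power_add pm mult_ac)
      have "\<rho> * \<sigma> * q ^ (2 * r + m) = ?x * ?y * q ^ m"
        unfolding mult_2 power_add by (simp only: mult_ac)
      then have "qpoch (\<rho> * \<sigma>) q (2 * r + m + (M - m)) =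
          qpoch (\<rho> * \<sigma>) q (2 * r + m) * qpoch (?x * ?y * q ^ m) q (M - m)"
        using qpoch_add[of "\<rho> * \<sigma>" q "2 * r + m" "M - m"]
        by (simp only:)
      with m have 2: "qpoch (\<rho> * \<sigma>) q (2 * r + M) =
          qpoch (\<rho> * \<sigma>) q (2 * r + m) * qpoch (?x * ?y * q ^ m) q (M - m)" by simp
      have nz': "qpoch (?x * ?y * q ^ m) q (M - m) \<noteq> 0"
        using nz(2)[of "2 * r + M"] 2 by auto
      show "w (m + r) / (qpoch q q (M - m) * qpoch q q m * qpoch (\<rho> * \<sigma>) q (2 * r + m)) =
        w r / (qpoch q q M * qpoch (\<rho> * \<sigma>) q (2 * r + M)) *
        (qbinom q M m * (qpoch ?x q m * (- ?y) ^ m * q ^ (m choose 2) * qpoch (?x * ?y * q ^ m) q (M - m)))"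
        unfolding 1 2 qbinom_eq_quotient[OF q m] using nz nz' by (simp add: divide_simps)
    qed
    also have "\<dots> = w r / (qpoch q q M * qpoch (\<rho> * \<sigma>) q (2 * r + M)) * qpoch ?y q M"
      unfolding sum_distrib_left[symmetric] q_Chu_Vandermonde ..
    finally show ?thesis by (simp add: N mult_2 add_ac)
  qed
  have "(\<Sum>n\<le>N. w n * \<beta> n / qpoch q q (N - n)) =
    (\<Sum>n\<le>N. \<Sum>r\<le>n. \<alpha> r * (w n / (qpoch q q (N - n) * qpoch q q (n - r) * qpoch (\<rho> * \<sigma>) q (n + r))))"
    unfolding \<beta> by (simp add: sum_distrib_left sum_divide_distrib mult_ac)
  also have "\<dots> = (\<Sum>r\<le>N. \<Sum>n\<in>{r..N}. \<alpha> r * (w n / (qpoch q q (N - n) * qpoch q q (n - r) * qpoch (\<rho> * \<sigma>) q (n + r))))"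
proof -
    have "{..n} = {r \<in> {..N}. r \<le> n}" if "n \<in> {..N}" for n using that by auto
    moreover have "{r..N} = {n \<in> {..N}. r \<le> n}" for r by auto
    ultimately show ?thesis
      using sum.swap_restrict[of "{..N}" "{..N}" _ "\<lambda>n r. r \<le> n"] by simp
  qed
  also have "\<dots> = (\<Sum>r\<le>N. \<alpha> r * (w r * qpoch (\<sigma> * q ^ r) q (N - r) / (qpoch q q (N - r) * qpoch (\<rho> * \<sigma>) q (N + r))))"
    unfolding sum_distrib_left[symmetric] using inner by (intro sum.cong) auto
  finally show ?thesis unfolding w_def by (simp add: mult_ac)
qed

section \<open>Infinite products and limits of sums\<close>

lemma convergent_prod_qpoch:
  fixes a q :: complex
  assumes "norm q < 1"
  shows "convergent_prod (\<lambda>j. 1 - a * q ^ j)"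
proof -
  have "summable (\<lambda>j. norm a * norm q ^ j)"
    using assms by (intro summable_mult summable_geometric) auto
  then show ?thesis
    by (intro abs_convergent_prod_imp_convergent_prod summable_imp_abs_convergent_prod)
      (simp add: norm_mult norm_power)
qed

lemma qpoch_LIMSEQ:
  assumes "norm q < 1"
  shows "qpoch a q \<longlonglongrightarrow> qpoch_inf a q"
  unfolding qpoch_inf_def qpoch_def[abs_def] LIMSEQ_lessThan_iff_atMost
  by (intro convergent_prod_LIMSEQ convergent_prod_qpoch assms)

lemma qpoch_inf_nonzero:
  assumes "norm a < 1" "norm q < 1"
  shows "qpoch_inf a q \<noteq> 0"
  unfolding qpoch_inf_def using one_minus_mult_power_nonzero[OF assms]
  by (intro prodinf_nonzero convergent_prod_qpoch assms)

lemma inverse_qpoch_LIMSEQ: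
  assumes "norm a < 1" "norm q < 1"
  shows "(\<lambda>n. 1 / qpoch a q n) \<longlonglongrightarrow> 1 / qpoch_inf a q"
  using assms by (intro tendsto_intros qpoch_LIMSEQ qpoch_inf_nonzero)

lemma qpoch_bounded:
  assumes "norm q < 1"
  obtains K where "K > 0" "\<And>n. norm (qpoch a q n) \<le> K"
  using convergent_imp_Bseq[OF convergentI[OF qpoch_LIMSEQ[OF assms, of a]]]
  unfolding Bseq_def by blast

lemma inverse_qpoch_bounded:
  assumes "norm a < 1" "norm q < 1"
  obtains K where "K > 0" "\<And>n. norm (1 / qpoch a q n) \<le> K"
  using convergent_imp_Bseq[OF convergentI[OF inverse_qpoch_LIMSEQ[OF assms]]]
  unfolding Bseq_def by blast

text \<open>Tannery's theorem for triangular sums: padding with zeros beyond \<open>N\<close> gives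
  series dominated by \<open>norm (b r) * K\<close>. As \<open>L\<close> is the same for all
  \<open>r\<close>, it factors out.\<close>

lemma LIMSEQ_sum_atMost_mult:
  fixes b :: "nat \<Rightarrow> complex"
  assumes b: "summable (\<lambda>r. norm (b r))"
    and K: "\<And>N r. r \<le> N \<Longrightarrow> norm (c N r) \<le> K"
    and L: "\<And>r. (\<lambda>N. c N r) \<longlonglongrightarrow> L"
  shows "(\<lambda>N. \<Sum>r\<le>N. b r * c N r) \<longlonglongrightarrow> suminf b * L"
proof -
  define a where "a r N = (if r \<le> N then b r * c N r else 0)" for r N
  have K0: "K \<ge> 0" using K[of 0 0] norm_ge_zero order_trans by blast
  have "(\<lambda>N. a r N) \<longlonglongrightarrow> b r * L" for r
  proof (rule Lim_transform_eventually)
    show "(\<lambda>N. b r * c N r) \<longlonglongrightarrow> b r * L" by (intro tendsto_intros L)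
    show "\<forall>\<^sub>F N in sequentially. b r * c N r = a r N"
      using eventually_ge_at_top[of r] by eventually_elim (simp add: a_def)
  qed
  moreover have "norm (a r N) \<le> norm (b r) * K" for r N
    using K[of r N] K0 by (simp add: a_def norm_mult mult_left_mono)
  ultimately have "(\<lambda>N. \<Sum>r. a r N) \<longlonglongrightarrow> (\<Sum>r. b r * L)"
    using summable_mult2[OF b, of K]
    by (intro conjunct2[OF conjunct2[OF tannerys_theorem[where M = "\<lambda>r. norm (b r) * K"]]])
      (auto intro: always_eventually)
  also have "(\<lambda>N. \<Sum>r. a r N) = (\<lambda>N. \<Sum>r\<le>N. b r * c N r)"
  proof
    fix N
    have "(\<Sum>r. a r N) = (\<Sum>r\<le>N. a r N)" by (intro suminf_finite) (auto simp: a_def)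
    then show "(\<Sum>r. a r N) = (\<Sum>r\<le>N. b r * c N r)" by (simp add: a_def)
  qed
  also have "(\<Sum>r. b r * L) = suminf b * L"
    by (rule suminf_mult2[symmetric]) (rule summable_norm_cancel[OF b])
  finally show ?thesis .
qed

section \<open>Splitting and merging products under a change of base\<close>

lemma qpoch_mult_index:
  "qpoch a q (m * n) = (\<Prod>i<m. qpoch (a * q ^ i) (q ^ m) n)"
proof (induction n)
  case (Suc n)
  have "qpoch a q (m * Suc n) = qpoch a q (m * n) * qpoch (a * q ^ (m * n)) q m"
    by (simp add: qpoch_add add.commute[of m])
  also have "qpoch (a * q ^ (m * n)) q m = (\<Prod>i<m. 1 - a * q ^ i * (q ^ m) ^ n)"
    unfolding qpoch_def by (simp add: power_mult mult_ac)
  finally show ?case unfolding Suc.IH by (simp add: qpoch_Suc prod.distrib)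
qed simp

lemma qpoch_inf_dissect:
  assumes "norm q < 1" "m > 0"
  shows "qpoch_inf a q = (\<Prod>i<m. qpoch_inf (a * q ^ i) (q ^ m))"
proof (rule LIMSEQ_unique)
  have "filterlim (\<lambda>n. m * n) at_top sequentially"
    using assms(2) by (intro mult_nat_left_at_top)
  from filterlim_compose[OF qpoch_LIMSEQ[OF assms(1)] this]
  show "(\<lambda>n. qpoch a q (m * n)) \<longlonglongrightarrow> qpoch_inf a q" .
  have "norm (q ^ m) < 1" using assms by (simp add: norm_power power_less_one_iff)
  then show "(\<lambda>n. qpoch a q (m * n)) \<longlonglongrightarrow> (\<Prod>i<m. qpoch_inf (a * q ^ i) (q ^ m))"
    unfolding qpoch_mult_index by (intro tendsto_prod qpoch_LIMSEQ)
qed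

text \<open>Difference of squares in each factor; this later removes the products with negative
  argument.\<close>

lemma qpoch_inf_mult_minus:
  assumes "norm q < 1"
  shows "qpoch_inf a q * qpoch_inf (- a) q = qpoch_inf (a\<^sup>2) (q\<^sup>2)"
proof (rule LIMSEQ_unique)
  show "(\<lambda>n. qpoch a q n * qpoch (- a) q n) \<longlonglongrightarrow> qpoch_inf a q * qpoch_inf (- a) q"
    using assms by (intro tendsto_intros qpoch_LIMSEQ)
  have "qpoch a q n * qpoch (- a) q n = qpoch (a\<^sup>2) (q\<^sup>2) n" for n
    by (simp add: qpoch_def algebra_simps power2_eq_square power_mult_distrib flip: prod.distrib)
  moreover have "norm (q\<^sup>2) < 1" using assms by (simp add: norm_power power_less_one_iff)
  ultimately show "(\<lambda>n. qpoch a q n * qpoch (- a) q n) \<longlonglongrightarrow> qpoch_inf (a\<^sup>2) (q\<^sup>2)"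
    by (simp add: qpoch_LIMSEQ)
qed

section \<open>The Jacobi triple product\<close>

lemma qbinom_symmetric:
  "norm q < 1 \<Longrightarrow> k \<le> n \<Longrightarrow> qbinom q n (n - k) = qbinom q n k"
  by (simp add: qbinom_eq_quotient mult.commute)

lemma sum_lessThan_add:
  fixes g :: "nat \<Rightarrow> complex"
  shows "(\<Sum>k<m + n. g k) = (\<Sum>k<m. g k) + (\<Sum>k<n. g (m + k))"
  by (induction n) (simp_all add: add_ac)

lemma two_choose_two: "2 * (n choose 2) + n = n * n"
  by (induction n) (simp_all add: numeral_2_eq_2)

lemma prod_mult_power: "(\<Prod>j<n. a * q ^ j) = a ^ n * (q::complex) ^ (n choose 2)"
  by (induction n) (simp_all add: numeral_2_eq_2 power_add mult_ac)

text \<open>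
  In Ramanujan's two-variable form, with the terms of index \<open>r\<close> and \<open>-r-1\<close> of the bilateral
  sum paired so that all exponents are natural numbers. It is the \<open>q\<close>-binomial theorem in base
  \<open>p = x * y\<close> at the point \<open>x / p ^ N\<close>.
\<close>

lemma Jacobi_triple_finite:
  fixes x y :: complex
  assumes xy: "norm (x * y) < 1" and nz: "x \<noteq> 0" "y \<noteq> 0"
  shows "(\<Sum>r\<le>N. (-1) ^ r * y ^ (Suc r choose 2) * x ^ (r choose 2) * (1 - x ^ (2 * r + 1)) *
      qbinom (x * y) (2 * N + 1) (N - r)) = qpoch x (x * y) (Suc N) * qpoch y (x * y) N"
proof -
  define p where "p = x * y"
  have p: "p \<noteq> 0" "norm p < 1" using assms by (auto simp: p_def)
  define Y where "Y = x / p ^ N"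
  \<comment> \<open>\<open>Z\<close> is the product of all \<open>- y * p^j\<close> with
    \<open>j < N\<close>. Matched in reverse order with the factors of \<open>qpoch Y p N\<close>,
    it turns them into those of \<open>qpoch y p N\<close>.\<close>
  define Z where "Z = (- y) ^ N * p ^ (N choose 2)"
  define c where "c k = Z * ((- Y) ^ k * p ^ (k choose 2))" for k
  have "Z * qpoch Y p N = (\<Prod>j<N. - y * p ^ j) * (\<Prod>j<N. 1 - Y * p ^ (N - Suc j))"
    unfolding Z_def qpoch_def prod_mult_power prod.nat_diff_reindex[of "\<lambda>j. 1 - Y * p ^ j"] ..
  also have "\<dots> = (\<Prod>j<N. - y * p ^ j * (1 - Y * p ^ (N - Suc j)))"
    by (rule prod.distrib[symmetric])
  also have "\<dots> = qpoch y p N"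
    unfolding qpoch_def
  proof (intro prod.cong refl)
    fix j assume "j \<in> {..<N}"
    then have "j < N" by simp
    then obtain d where "N = Suc (j + d)" using less_imp_Suc_add by blast
    then have "p ^ N = p ^ j * p * p ^ (N - Suc j)"
      by (simp add: power_add)
    then have "y * p ^ j * (Y * p ^ (N - Suc j)) = 1"
      using p nz by (simp add: Y_def p_def)
    then show "- y * p ^ j * (1 - Y * p ^ (N - Suc j)) = 1 - y * p ^ j"
      by (simp add: algebra_simps)
  qed
  finally have Z: "Z * qpoch Y p N = qpoch y p N" .
  \<comment> \<open>The lower half of the expansion, at distance \<open>r\<close> below index
    \<open>N\<close>. Multiplying by \<open>p^(N*k)\<close> removes the negative powers;
    \<open>e\<close> then compares the exponents of \<open>y\<close> and of
    \<open>x\<close>.\<close>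
  have c1: "c k = (-1) ^ r * y ^ (Suc r choose 2) * x ^ (r choose 2)" if N: "N = k + r" for k r
  proof -
    have e: "N + (N choose 2) + (k choose 2) = N * k + (Suc r choose 2)"
      "(N choose 2) + (k + (k choose 2)) = N * k + (r choose 2)"
      using two_choose_two[of k] add_choose_two[of k r]
      by (simp_all add: N numeral_2_eq_2 algebra_simps)
    have "c k * p ^ (N * k) = (-1) ^ (N + k) * (y ^ N * p ^ (N choose 2) * x ^ k * p ^ (k choose 2))"
      using p by (simp add: c_def Z_def Y_def power_mult power_divide power_add power_minus[of y]
        power_minus[of "x / p ^ N"] mult_ac)
    also have "y ^ N * p ^ (N choose 2) * x ^ k * p ^ (k choose 2) =
        y ^ (N + (N choose 2) + (k choose 2)) * x ^ ((N choose 2) + (k + (k choose 2)))"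
      by (simp add: p_def power_add power_mult_distrib mult_ac)
    also have "\<dots> = y ^ (Suc r choose 2) * x ^ (r choose 2) * p ^ (N * k)"
      unfolding e by (simp add: p_def power_add power_mult_distrib mult_ac)
    also have "(-1::complex) ^ (N + k) = (-1) ^ r" by (simp add: N power_add)
    finally show ?thesis using p by (simp add: mult_ac)
  qed
  \<comment> \<open>The upper half, computed alike; the extra \<open>- x^(2*r+1)\<close> produces
    the factor \<open>1 - x^(2*r+1)\<close> after pairing.\<close>
  have c2: "c k = - ((-1) ^ r * y ^ (Suc r choose 2) * x ^ (r choose 2) * x ^ (2 * r + 1))"
    if k: "k = N + Suc r" for k r
  proof -
    have e: "N + (N choose 2) + (k choose 2) = N * k + (Suc r choose 2)"
      "(N choose 2) + (k + (k choose 2)) = N * k + ((r choose 2) + (2 * r + 1))"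
      using two_choose_two[of N] add_choose_two[of N "Suc r"]
      by (simp_all add: k numeral_2_eq_2 algebra_simps)
    have "c k * p ^ (N * k) = (-1) ^ (N + k) * (y ^ N * p ^ (N choose 2) * x ^ k * p ^ (k choose 2))"
      using p by (simp add: c_def Z_def Y_def power_mult power_divide power_add power_minus[of y]
        power_minus[of "x / p ^ N"] mult_ac)
    also have "y ^ N * p ^ (N choose 2) * x ^ k * p ^ (k choose 2) =
        y ^ (N + (N choose 2) + (k choose 2)) * x ^ ((N choose 2) + (k + (k choose 2)))"
      by (simp add: p_def power_add power_mult_distrib mult_ac)
    also have "\<dots> = y ^ (Suc r choose 2) * x ^ (r choose 2) * x ^ (2 * r + 1) * p ^ (N * k)"
      unfolding e by (simp add: p_def power_add power_mult_distrib mult_ac)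
    also have "(-1::complex) ^ (N + k) = - ((-1) ^ r)" by (simp add: k power_add)
    finally have "c k * p ^ (N * k) =
        - ((-1) ^ r * y ^ (Suc r choose 2) * x ^ (r choose 2) * x ^ (2 * r + 1)) * p ^ (N * k)"
      by (simp only: mult_minus_left mult_minus_right mult_ac)
    then show ?thesis using p by (metis mult_right_cancel power_not_zero)
  qed
  \<comment> \<open>The last \<open>N + 1\<close> factors of the long product start at
    \<open>Y * p^N = x\<close>.\<close>
  have "qpoch x p (Suc N) * qpoch y p N = Z * qpoch Y p (N + Suc N)"
    unfolding qpoch_add[of Y p N "Suc N"] Z[symmetric] using p by (simp add: Y_def)
  also have "\<dots> = (\<Sum>k<Suc N + Suc N. c k * qbinom p (2 * N + 1) k)"
    unfolding q_binomial_theorem[symmetric] c_def sum_distrib_left lessThan_Suc_atMost[symmetric]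
    by (intro sum.cong) (auto simp: mult_2)
  \<comment> \<open>The indices \<open>N - r\<close> and \<open>N + r + 1\<close> add up to
    \<open>2*N + 1\<close>, so their \<open>q\<close>-binomial coefficients agree.\<close>
  also have "\<dots> = (\<Sum>r\<le>N. c (N - r) * qbinom p (2 * N + 1) (N - r) +
      c (N + Suc r) * qbinom p (2 * N + 1) (N + Suc r))"
    unfolding sum_lessThan_add sum.distrib
    by (subst sum.nat_diff_reindex[symmetric, of _ "Suc N"]) (simp add: lessThan_Suc_atMost)
  also have "\<dots> = (\<Sum>r\<le>N. (-1) ^ r * y ^ (Suc r choose 2) * x ^ (r choose 2) *
      (1 - x ^ (2 * r + 1)) * qbinom p (2 * N + 1) (N - r))"
  proof (intro sum.cong refl)
    fix r assume "r \<in> {..N}"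
    then have r: "r \<le> N" by simp
    have "qbinom p (2 * N + 1) (2 * N + 1 - (N - r)) = qbinom p (2 * N + 1) (N - r)"
      by (rule qbinom_symmetric[OF p(2)]) simp
    then have s: "qbinom p (2 * N + 1) (N + Suc r) = qbinom p (2 * N + 1) (N - r)"
      using r by (simp add: Suc_diff_le mult_2)
    have "c (N - r) = (-1) ^ r * y ^ (Suc r choose 2) * x ^ (r choose 2)"
      using r by (intro c1) simp
    then show "c (N - r) * qbinom p (2 * N + 1) (N - r) +
        c (N + Suc r) * qbinom p (2 * N + 1) (N + Suc r) =
      (-1) ^ r * y ^ (Suc r choose 2) * x ^ (r choose 2) *
        (1 - x ^ (2 * r + 1)) * qbinom p (2 * N + 1) (N - r)"
      unfolding s c2[OF refl] by (simp add: algebra_simps del: power_Suc)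
  qed
  finally show ?thesis unfolding p_def ..
qed

text \<open>The exponent of \<open>y\<close> is at least \<open>r\<close>, so a geometric series
  dominates; the 2 bounds the last factor.\<close>

lemma Jacobi_triple_summable:
  fixes x y :: complex
  assumes x: "norm x < 1" and y: "norm y < 1"
  shows "summable (\<lambda>r. norm ((-1) ^ r * y ^ (Suc r choose 2) * x ^ (r choose 2) * (1 - x ^ (2 * r + 1))))"
proof (rule summable_comparison_test'[where N = 0 and g = "\<lambda>r. norm y ^ r * 2"])
  show "summable (\<lambda>r. norm y ^ r * 2)"
    using y by (intro summable_mult2 summable_geometric) auto
  fix r :: nat
  have "norm y ^ (Suc r choose 2) \<le> norm y ^ r"
    using y by (intro power_decreasing) (auto simp: numeral_2_eq_2)
  moreover have "norm x ^ (r choose 2) \<le> 1" "norm x ^ (2 * r + 1) \<le> 1"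
    using x by (auto intro!: power_le_one simp del: power_Suc)
  moreover have "norm (1 - x ^ (2 * r + 1)) \<le> 1 + norm x ^ (2 * r + 1)"
    using norm_triangle_ineq4[of 1 "x ^ (2 * r + 1)"] by (simp add: norm_power norm_mult)
  ultimately have "norm y ^ (Suc r choose 2) * norm x ^ (r choose 2) * norm (1 - x ^ (2 * r + 1)) \<le>
      norm y ^ r * 1 * 2"
    by (intro mult_mono) auto
  then show "norm (norm ((-1) ^ r * y ^ (Suc r choose 2) * x ^ (r choose 2) * (1 - x ^ (2 * r + 1))))
      \<le> norm y ^ r * 2"
    by (simp add: norm_mult norm_power)
qed

text \<open>The limit of the finite form: for fixed \<open>r\<close> the \<open>q\<close>-binomial
  coefficient, as a quotient, tends to \<open>1 / P\<close> under a uniform bound. Multiplying by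
  \<open>P\<close> yields the third product.\<close>

lemma Jacobi_triple_product:
  fixes x y :: complex
  assumes x: "norm x < 1" "x \<noteq> 0" and y: "norm y < 1" "y \<noteq> 0"
  shows "(\<Sum>r. (-1) ^ r * y ^ (Suc r choose 2) * x ^ (r choose 2) * (1 - x ^ (2 * r + 1))) =
    qpoch_inf x (x * y) * qpoch_inf y (x * y) * qpoch_inf (x * y) (x * y)"
proof -
  define p where "p = x * y"
  define b where "b r = (-1) ^ r * y ^ (Suc r choose 2) * x ^ (r choose 2) * (1 - x ^ (2 * r + 1))" for r
  define P where "P = qpoch_inf p p"
  have p: "norm p < 1"
    using mult_strict_mono[OF x(1) y(1)] by (simp add: p_def norm_mult)
  obtain K1 where K1: "K1 > 0" "\<And>n. norm (qpoch p p n) \<le> K1"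
    using qpoch_bounded[OF p] by metis
  obtain K2 where K2: "K2 > 0" "\<And>n. norm (1 / qpoch p p n) \<le> K2"
    using inverse_qpoch_bounded[OF p p] by metis
  have shift: "filterlim (\<lambda>N. N - r) at_top sequentially"
    "filterlim (\<lambda>N. 2 * N + 1 - (N - r)) at_top sequentially"
    "filterlim (\<lambda>N. 2 * N + 1) at_top sequentially" for r :: nat
  proof -
    show *: "filterlim (\<lambda>N. N - r) at_top sequentially" for r
      by (rule filterlim_minus_const_nat_at_top)
    show "filterlim (\<lambda>N. 2 * N + 1) at_top sequentially"
      by (rule filterlim_at_top_mono[OF filterlim_ident]) auto
    show "filterlim (\<lambda>N. 2 * N + 1 - (N - r)) at_top sequentially"
      by (rule filterlim_at_top_mono[OF filterlim_ident]) (auto intro!: always_eventually)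
  qed
  have "(\<lambda>N. \<Sum>r\<le>N. b r * (qpoch p p (2 * N + 1) *
      ((1 / qpoch p p (N - r)) * (1 / qpoch p p (2 * N + 1 - (N - r)))))) \<longlonglongrightarrow>
      suminf b * (P * (1 / P * (1 / P)))"
  proof (rule LIMSEQ_sum_atMost_mult)
    show "summable (\<lambda>r. norm (b r))"
      unfolding b_def by (rule Jacobi_triple_summable[OF x(1) y(1)])
    show "norm (qpoch p p (2 * N + 1) *
      ((1 / qpoch p p (N - r)) * (1 / qpoch p p (2 * N + 1 - (N - r))))) \<le> K1 * (K2 * K2)" for N r
      unfolding norm_mult using K1 K2
      by (intro mult_mono) (auto simp del: norm_divide simp: less_imp_le)
    show "(\<lambda>N. qpoch p p (2 * N + 1) *
      ((1 / qpoch p p (N - r)) * (1 / qpoch p p (2 * N + 1 - (N - r))))) \<longlonglongrightarrow> P * (1 / P * (1 / P))" for r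
      unfolding P_def
      by (intro tendsto_mult filterlim_compose[OF qpoch_LIMSEQ[OF p] shift(3)]
          filterlim_compose[OF inverse_qpoch_LIMSEQ[OF p p] shift(1)]
          filterlim_compose[OF inverse_qpoch_LIMSEQ[OF p p] shift(2)])
  qed
  also have "(\<lambda>N. \<Sum>r\<le>N. b r * (qpoch p p (2 * N + 1) *
      ((1 / qpoch p p (N - r)) * (1 / qpoch p p (2 * N + 1 - (N - r)))))) =
      (\<lambda>N. qpoch x p (Suc N) * qpoch y p N)"
    using Jacobi_triple_finite[of x y] p x(2) y(2)
    by (simp add: qbinom_eq_quotient b_def flip: p_def)
  finally have "(\<lambda>N. qpoch x p (Suc N) * qpoch y p N) \<longlonglongrightarrow> suminf b * (P * (1 / P * (1 / P)))" .
  moreover have "(\<lambda>N. qpoch x p (Suc N) * qpoch y p N) \<longlonglongrightarrow> qpoch_inf x p * qpoch_inf y p"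
    by (intro tendsto_mult LIMSEQ_Suc qpoch_LIMSEQ p)
  ultimately have "suminf b * (P * (1 / P * (1 / P))) = qpoch_inf x p * qpoch_inf y p"
    by (rule LIMSEQ_unique)
  moreover have "P \<noteq> 0" unfolding P_def by (rule qpoch_inf_nonzero[OF p p])
  ultimately have "suminf b = qpoch_inf x p * qpoch_inf y p * P" by (simp add: field_simps)
  then show ?thesis unfolding b_def[abs_def] P_def p_def .
qed

section \<open>The series\<close>

text \<open>The Bailey lemma in base \<open>p\<close> with \<open>\<rho> = - q\<close> and
  \<open>\<sigma> = - q^3\<close>, whence \<open>\<rho> * \<sigma> = p * p\<close>.\<close>

lemma truncated_series_eq_truncated_theta:
  fixes q :: complex
  assumes q: "norm q < 1"
  shows "(\<Sum>n\<le>N. qpoch (- q) (q\<^sup>2) n * q ^ (n\<^sup>2 + 2 * n) / qpoch (q ^ 4) (q ^ 4) n *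
      (1 / qpoch (q\<^sup>2) (q\<^sup>2) (N - n))) =
    qpoch (- q) (q\<^sup>2) (Suc N) *
    (\<Sum>r\<le>N. (-1) ^ r * (q ^ 5) ^ (Suc r choose 2) * q ^ (r choose 2) * (1 - q ^ (2 * r + 1)) *
      (1 / qpoch (q\<^sup>2) (q\<^sup>2) (N - r) * (1 / qpoch (q\<^sup>2) (q\<^sup>2) (N + r + 1))))"
proof -
  define p where "p = q\<^sup>2"
  have p: "norm p < 1" using q by (simp add: p_def norm_power power_less_one_iff)
  have p1: "1 - p \<noteq> 0" using one_minus_power_Suc_nonzero[OF p, of 0] by simp
  have \<rho>\<sigma>: "(- q) * (- (q ^ 3)) = p * p" by (simp add: p_def flip: power_add power_Suc)
  have pp: "qpoch (p * p) p k = qpoch p p (Suc k) / (1 - p)" for k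
    using p1 by (simp add: qpoch_Suc_shift)
  define \<alpha> where "\<alpha> r = (-1) ^ r * p ^ r\<^sup>2 * (1 - p ^ (2 * r + 1)) / (1 - p)" for r
  have Bailey: "(\<Sum>n\<le>N. qpoch (- q) p n * (- (- (q ^ 3))) ^ n * p ^ (n choose 2) *
      (1 / qpoch (p\<^sup>2) (p\<^sup>2) n) / qpoch p p (N - n)) =
    (\<Sum>r\<le>N. qpoch (- q) p r * qpoch (- (q ^ 3) * p ^ r) p (N - r) * (- (- (q ^ 3))) ^ r *
      p ^ (r choose 2) * \<alpha> r / (qpoch p p (N - r) * qpoch (- q * - (q ^ 3)) p (N + r)))"
  proof (rule Bailey_lemma_finite[OF p])
    show "norm (- q * - (q ^ 3)) < 1"
      unfolding \<rho>\<sigma> using mult_strict_mono[OF p p] by (simp add: norm_mult)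
    show "1 / qpoch (p\<^sup>2) (p\<^sup>2) n =
        (\<Sum>r\<le>n. \<alpha> r / (qpoch p p (n - r) * qpoch (- q * - (q ^ 3)) p (n + r)))" for n
      unfolding Bailey_pair_sum[OF p, symmetric] \<rho>\<sigma> pp \<alpha>_def using p1 by simp
  qed
  have "(q ^ 3) ^ n * p ^ (n choose 2) = q ^ (n\<^sup>2 + 2 * n)" for n
  proof -
    have e: "3 * n + 2 * (n choose 2) = n\<^sup>2 + 2 * n"
      using two_choose_two[of n] by (simp add: power2_eq_square)
    show ?thesis unfolding p_def power_mult[symmetric] power_add[symmetric] e ..
  qed
  then have "(\<Sum>n\<le>N. qpoch (- q) p n * q ^ (n\<^sup>2 + 2 * n) / qpoch (q ^ 4) (q ^ 4) n *
      (1 / qpoch p p (N - n))) =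
    (\<Sum>n\<le>N. qpoch (- q) p n * (- (- (q ^ 3))) ^ n * p ^ (n choose 2) *
      (1 / qpoch (p\<^sup>2) (p\<^sup>2) n) / qpoch p p (N - n))"
    by (simp add: p_def mult.assoc flip: power_mult)
  also have "\<dots> = (\<Sum>r\<le>N. qpoch (- q) p (Suc N) *
      ((-1) ^ r * (q ^ 5) ^ (Suc r choose 2) * q ^ (r choose 2) * (1 - q ^ (2 * r + 1)) *
      (1 / qpoch p p (N - r) * (1 / qpoch p p (N + r + 1)))))"
    unfolding Bailey
  proof (intro sum.cong refl)
    fix r assume "r \<in> {..N}"
    then have N: "Suc N = r + Suc (N - r)" by auto
    have pr: "q * p ^ r = q ^ (2 * r + 1)"
      by (simp add: p_def power_mult)
    have pr': "q ^ (2 * r + 1) * p = q ^ 3 * p ^ r"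
      unfolding pr[symmetric] by (simp add: p_def power2_eq_square power3_eq_cube mult_ac)
    \<comment> \<open>The factor \<open>1 + q^(2*r+1)\<close> missing between the two Pochhammer
      symbols is supplied by \<open>1 - p^(2*r+1)\<close> in \<open>\<alpha> r\<close>. The
      completed product is free of \<open>r\<close> and leaves the sum.\<close>
    have 1: "qpoch (- q) p (Suc N) =
        qpoch (- q) p r * ((1 + q ^ (2 * r + 1)) * qpoch (- (q ^ 3) * p ^ r) p (N - r))"
      unfolding N qpoch_add[of "- q"] qpoch_Suc_shift by (simp only: mult_minus_left pr pr' diff_minus_eq_add)
    have 2: "1 - p ^ (2 * r + 1) = (1 - q ^ (2 * r + 1)) * (1 + q ^ (2 * r + 1))"
      by (simp add: p_def algebra_simps del: power_Suc flip: power_mult power_add)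
    \<comment> \<open>Both sides are \<open>3*r^2 + 2*r\<close>; the right one has the shape of the
      triple product at \<open>x = q\<close>, \<open>y = q^5\<close>.\<close>
    have e: "3 * r + 2 * (r choose 2) + 2 * r\<^sup>2 = 5 * (Suc r choose 2) + (r choose 2)"
      using two_choose_two[of r] add_choose_two[of r 1] by (simp add: power2_eq_square binomial_eq_0)
    have 3: "(- (- (q ^ 3))) ^ r * p ^ (r choose 2) * p ^ r\<^sup>2 = (q ^ 5) ^ (Suc r choose 2) * q ^ (r choose 2)"
      unfolding p_def minus_minus power_mult[symmetric] power_add[symmetric] e ..
    have "qpoch (- q) p r * qpoch (- (q ^ 3) * p ^ r) p (N - r) * (- (- (q ^ 3))) ^ r *
        p ^ (r choose 2) * \<alpha> r / (qpoch p p (N - r) * qpoch (- q * - (q ^ 3)) p (N + r)) =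
      (qpoch (- q) p r * ((1 + q ^ (2 * r + 1)) * qpoch (- (q ^ 3) * p ^ r) p (N - r))) *
        ((-1) ^ r * ((- (- (q ^ 3))) ^ r * p ^ (r choose 2) * p ^ r\<^sup>2) * (1 - q ^ (2 * r + 1)) *
        (1 / qpoch p p (N - r) * (1 / qpoch p p (N + r + 1))))"
      unfolding \<rho>\<sigma> pp \<alpha>_def 2 using p1 by (simp add: mult_ac del: power_Suc)
    then show "qpoch (- q) p r * qpoch (- (q ^ 3) * p ^ r) p (N - r) * (- (- (q ^ 3))) ^ r *
        p ^ (r choose 2) * \<alpha> r / (qpoch p p (N - r) * qpoch (- q * - (q ^ 3)) p (N + r)) =
      qpoch (- q) p (Suc N) *
      ((-1) ^ r * (q ^ 5) ^ (Suc r choose 2) * q ^ (r choose 2) * (1 - q ^ (2 * r + 1)) *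
      (1 / qpoch p p (N - r) * (1 / qpoch p p (N + r + 1))))"
      unfolding 1 3 by (simp only: mult.assoc)
  qed
  finally show ?thesis unfolding p_def sum_distrib_left .
qed

lemma summable_series:
  fixes q :: complex
  assumes q: "norm q < 1"
  shows "summable (\<lambda>n. norm (qpoch (- q) (q\<^sup>2) n * q ^ (n\<^sup>2 + 2 * n) / qpoch (q ^ 4) (q ^ 4) n))"
proof -
  have q2: "norm (q\<^sup>2) < 1" and q4: "norm (q ^ 4) < 1"
    using q by (simp_all add: norm_power power_less_one_iff)
  obtain K1 where K1: "K1 > 0" "\<And>n. norm (qpoch (- q) (q\<^sup>2) n) \<le> K1"
    using qpoch_bounded[OF q2] by metis
  obtain K2 where K2: "K2 > 0" "\<And>n. norm (1 / qpoch (q ^ 4) (q ^ 4) n) \<le> K2"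
    using inverse_qpoch_bounded[OF q4 q4] by metis
  show ?thesis
  proof (rule summable_comparison_test'[where N = 0 and g = "\<lambda>n. K1 * norm q ^ n * K2"])
    show "summable (\<lambda>n. K1 * norm q ^ n * K2)"
      using q by (intro summable_mult2 summable_mult summable_geometric) auto
    fix n :: nat
    have "norm q ^ (n\<^sup>2 + 2 * n) \<le> norm q ^ n"
      using q by (intro power_decreasing) auto
    then have "norm (qpoch (- q) (q\<^sup>2) n) * norm q ^ (n\<^sup>2 + 2 * n) * norm (1 / qpoch (q ^ 4) (q ^ 4) n)
        \<le> K1 * norm q ^ n * K2"
      using K1 K2 by (intro mult_mono) (auto simp del: norm_divide simp: less_imp_le)
    then show "norm (norm (qpoch (- q) (q\<^sup>2) n * q ^ (n\<^sup>2 + 2 * n) / qpoch (q ^ 4) (q ^ 4) n))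
        \<le> K1 * norm q ^ n * K2"
      by (simp add: norm_mult norm_divide norm_power)
  qed
qed

text \<open>As \<open>N\<close> grows, the truncated identity tends to \<open>suminf a / P\<close>
  on the left and to \<open>qpoch_inf (- q) p * suminf b / P^2\<close> on the right; the triple
  product evaluates \<open>suminf b\<close>.\<close>

lemma suminf_series_eq_theta_product:
  fixes q :: complex
  assumes q: "norm q < 1" "q \<noteq> 0"
  shows "(\<Sum>n. qpoch (- q) (q\<^sup>2) n * q ^ (n\<^sup>2 + 2 * n) / qpoch (q ^ 4) (q ^ 4) n) =
    qpoch_inf (- q) (q\<^sup>2) * (qpoch_inf q (q ^ 6) * qpoch_inf (q ^ 5) (q ^ 6) * qpoch_inf (q ^ 6) (q ^ 6)) /
    qpoch_inf (q\<^sup>2) (q\<^sup>2)"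
proof -
  define p where "p = q\<^sup>2"
  define a where "a n = qpoch (- q) p n * q ^ (n\<^sup>2 + 2 * n) / qpoch (q ^ 4) (q ^ 4) n" for n
  define b where "b r = (-1) ^ r * (q ^ 5) ^ (Suc r choose 2) * q ^ (r choose 2) * (1 - q ^ (2 * r + 1))" for r
  define P where "P = qpoch_inf p p"
  have p: "norm p < 1" and q5: "norm (q ^ 5) < 1"
    using q by (simp_all add: p_def norm_power power_less_one_iff)
  have P: "P \<noteq> 0" unfolding P_def by (rule qpoch_inf_nonzero[OF p p])
  obtain K where K: "K > 0" "\<And>n. norm (1 / qpoch p p n) \<le> K"
    using inverse_qpoch_bounded[OF p p] by metis
  note lim = filterlim_compose[OF inverse_qpoch_LIMSEQ[OF p p]]
  have "(\<lambda>N. \<Sum>n\<le>N. a n * (1 / qpoch p p (N - n))) \<longlonglongrightarrow> suminf a * (1 / P)"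
  proof (rule LIMSEQ_sum_atMost_mult)
    show "summable (\<lambda>n. norm (a n))"
      unfolding a_def p_def by (rule summable_series[OF q(1)])
    show "(\<lambda>N. 1 / qpoch p p (N - n)) \<longlonglongrightarrow> 1 / P" for n
      unfolding P_def by (rule lim[OF filterlim_minus_const_nat_at_top])
  qed (rule K(2))
  moreover have "(\<lambda>N. qpoch (- q) p (Suc N) *
      (\<Sum>r\<le>N. b r * (1 / qpoch p p (N - r) * (1 / qpoch p p (N + r + 1))))) \<longlonglongrightarrow>
      qpoch_inf (- q) p * (suminf b * (1 / P * (1 / P)))"
  proof (intro tendsto_mult LIMSEQ_sum_atMost_mult LIMSEQ_Suc qpoch_LIMSEQ p)
    show "summable (\<lambda>n. norm (b n))"
      unfolding b_def by (rule Jacobi_triple_summable[OF q(1) q5])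
    show "norm (1 / qpoch p p (N - r) * (1 / qpoch p p (N + r + 1))) \<le> K * K" for N r
      unfolding norm_mult using K by (intro mult_mono) (auto simp del: norm_divide simp: less_imp_le)
    show "(\<lambda>N. 1 / qpoch p p (N - r)) \<longlonglongrightarrow> 1 / P" for r
      unfolding P_def by (rule lim[OF filterlim_minus_const_nat_at_top])
    show "(\<lambda>N. 1 / qpoch p p (N + r + 1)) \<longlonglongrightarrow> 1 / P" for r
      unfolding P_def by (rule lim, rule filterlim_at_top_mono[OF filterlim_ident]) (auto intro!: always_eventually)
  qed
  ultimately have "suminf a * (1 / P) = qpoch_inf (- q) p * (suminf b * (1 / P * (1 / P)))"
    using LIMSEQ_unique truncated_series_eq_truncated_theta[OF q(1)] unfolding a_def b_def p_def by force
  then have "suminf a = qpoch_inf (- q) p * suminf b / P"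
    using P by (simp add: field_simps)
  also have "suminf b = qpoch_inf q (q ^ 6) * qpoch_inf (q ^ 5) (q ^ 6) * qpoch_inf (q ^ 6) (q ^ 6)"
    using Jacobi_triple_product[OF q q5] q(2) unfolding b_def[abs_def] by (simp flip: power_Suc)
  finally show ?thesis unfolding a_def[abs_def] P_def p_def .
qed

text \<open>Everything is reduced to base \<open>q^12\<close>: \<open>M 1 * A 1 = B 2\<close> and
  \<open>M 5 * A 5 = B 10\<close> cancel against the denominator, while
  \<open>M 3 = B 6 / (B 3 * B 9)\<close> leaves the numerator \<open>B 6\<close>.\<close>

lemma theta_product_eq_product_mod_12:
  fixes q :: complex
  assumes q: "norm q < 1"
  shows "qpoch_inf (- q) (q\<^sup>2) *
      (qpoch_inf q (q ^ 6) * qpoch_inf (q ^ 5) (q ^ 6) * qpoch_inf (q ^ 6) (q ^ 6)) / qpoch_inf (q\<^sup>2) (q\<^sup>2) =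
    qpoch_inf (q ^ 6) (q ^ 12) / qpochs_inf [q ^ 3, q ^ 4, q ^ 8, q ^ 9] (q ^ 12)"
proof -
  have n: "norm (q ^ k) < 1" if "k > 0" for k using that q by (simp add: norm_power power_less_one_iff)
  have nz: "qpoch_inf (q ^ j) (q ^ k) \<noteq> 0" if "j > 0" "k > 0" for j k
    using that by (intro qpoch_inf_nonzero n)
  \<comment> \<open>The sign \<open>c\<close> lets one statement serve
    \<open>qpoch_inf (- q)\<close> and \<open>qpoch_inf (q^2)\<close>, both in base
    \<open>q^2\<close>.\<close>
  have three: "qpoch_inf (c * q ^ j) (q\<^sup>2) = qpoch_inf (c * q ^ j) (q ^ 6) *
      qpoch_inf (c * q ^ (j + 2)) (q ^ 6) * qpoch_inf (c * q ^ (j + 4)) (q ^ 6)" for c j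
    using qpoch_inf_dissect[OF n[of 2], of 3 "c * q ^ j"]
    by (simp add: eval_nat_numeral lessThan_Suc power_add mult_ac)
  have two: "qpoch_inf (q ^ j) (q ^ 6) = qpoch_inf (q ^ j) (q ^ 12) * qpoch_inf (q ^ (j + 6)) (q ^ 12)" for j
  proof -
    have "{..<2::nat} = {0, 1}" by auto
    then show ?thesis
      using qpoch_inf_dissect[OF n[of 6], of 2 "q ^ j"] by (simp add: power_add flip: power_mult)
  qed
  have pm: "qpoch_inf (- (q ^ j)) (q ^ 6) * qpoch_inf (q ^ j) (q ^ 6) = qpoch_inf (q ^ (j * 2)) (q ^ 12)" for j
    using qpoch_inf_mult_minus[OF n[of 6], of "q ^ j"] by (simp add: mult.commute flip: power_mult)
  define A where "A k = qpoch_inf (q ^ k) (q ^ 6)" for k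
  define M where "M k = qpoch_inf (- (q ^ k)) (q ^ 6)" for k
  define B where "B k = qpoch_inf (q ^ k) (q ^ 12)" for k
  have B: "B k \<noteq> 0" if "k > 0" for k using that nz by (simp add: B_def)
  have A6: "A 6 \<noteq> 0" using nz by (simp add: A_def)
  have "qpoch_inf (- q) (q\<^sup>2) = M 1 * M 3 * M 5"
    using three[of "- 1" 1] by (simp add: M_def power3_eq_cube mult.assoc)
  moreover have "qpoch_inf (q\<^sup>2) (q\<^sup>2) = B 2 * B 8 * (B 4 * B 10) * A 6"
    using three[of 1 2] two[of 2] two[of 4] by (simp add: A_def B_def)
  moreover have "M 1 * A 1 = B 2" "M 3 * (B 3 * B 9) = B 6" "M 5 * A 5 = B 10"
    using pm[of 1] pm[of 3] pm[of 5] two[of 3] by (simp_all add: M_def A_def B_def)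
  moreover have "M 1 * M 3 * M 5 * (A 1 * A 5 * A 6) / (B 2 * B 8 * (B 4 * B 10) * A 6) =
      (M 1 * A 1) * (M 5 * A 5) * (M 3 * (B 3 * B 9)) / (B 2 * B 10 * (B 3 * B 4 * B 8 * B 9))"
    using A6 B by (simp add: divide_simps)
  ultimately show ?thesis
    using B A6 by (simp add: A_def B_def qpochs_inf_def mult_ac)
qed

theorem theorem3p4:
  fixes q :: complex
  assumes "norm q < 1"
  shows "(\<lambda>n. qpoch (- q) (q ^ 2) n * q ^ (n ^ 2 + 2 * n) / qpoch (q ^ 4) (q ^ 4) n)
    sums (qpoch_inf (q ^ 6) (q ^ 12) / qpochs_inf [q ^ 3, q ^ 4, q ^ 8, q ^ 9] (q ^ 12))"
proof (cases "q = 0")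
  \<comment> \<open>The triple product was proved for nonzero arguments. At \<open>q = 0\<close>
    only the term \<open>n = 0\<close> survives, by \<open>0^0 = 1\<close>, and all products are
    1.\<close>
  case True
  have "qpoch_inf 0 0 = 1" by (simp add: qpoch_inf_def)
  moreover have "(\<lambda>n. qpoch 0 0 n * 0 ^ (n\<^sup>2 + 2 * n) / qpoch 0 0 n) sums (1::complex)"
    using sums_single[of 0 "\<lambda>_. 1 :: complex"]
    by (rule sums_cong[THEN iffD1, rotated]) (auto simp: qpoch_base_0)
  ultimately show ?thesis using True by (simp add: qpochs_inf_def)
next
  case False
  show ?thesis
    using summable_sums[OF summable_norm_cancel[OF summable_series[OF assms]]]
    unfolding suminf_series_eq_theta_product[OF assms False] theta_product_eq_product_mod_12[OF assms] .
qed

end
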